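(* Let $G$ be a graph and $R\subseteq V(G)$ with $|R|\ge 2$. If $G$ has a Pendant $R$-CIST or a Non-pendant $R$-CIST of size $k\le |R|$, then there exists a directed $R$-minor of $G$ that has a CISA of size $k$.
   Context: Graphs are finite and connected, may have parallel edges but no loops. For a (directed or undirected) tree $T$, $\mathrm{int}(T)$ is the set of vertices of degree at least 2 in the underlying undirected tree and $L(T)$ the set of the other vertices (leaves). An $R$-Steiner tree is a subtree $T$ of $G$ with $R\subseteq V(T)$ and $L(T)\subseteq R$; it is pendant if $L(T)=R$ and non-pendant if $\mathrm{int}(T)\cap R\neq\emptyset$. An $R$-CIST of size $k$ is a set $\{T_1,\dots,T_k\}$ of $R$-Steiner trees such that for all distinct $u,v\in R$ and distinct $i,j$, the $(u,v)$-paths in $T_i$ and $T_j$ are edge-disjoint and internally vertex-disjoint; it is Pendant (resp. Non-pendant) if all its trees are pendant (resp. non-pendant). Directed $R$-minor: let $\mathcal P=\{V_1,\dots,V_{|R|}\}$ be a partition of $V(G)$ with $|V_i\cap R|=1$ and $G[V_i]$ connected for all $i$; the directed $R$-minor induced by $\mathcal P$ is the digraph with vertex set $\mathcal P$ in which there is an arc $(V_i,V_j)$ ($i\ne j$) for each edge of $G$ joining a vertex of $V_i$ to the terminal in $V_j$ (so two adjacent terminals give a directed 2-cycle). An arborescence in a digraph is a tree in which every vertex except one (the root, of in-degree 0) has in-degree 1 in the tree. A CISA of size $k$ in a digraph $D$ is a set $\{T_1,\dots,T_k\}$ of spanning arborescences of $D$ with $\mathrm{int}(T_i)\cap\mathrm{int}(T_j)=\emptyset$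 and $A(T_i)\cap A(T_j)=\emptyset$ for all distinct $i,j$. *)

theory Defs
  imports "Graph_Theory.Graph_Theory" "HOL-Library.Disjoint_Sets"
begin

text \<open>
  Undirected multigraphs: \<open>uends e\<close> is the set of the two ends of the edge \<open>e\<close>, so distinct
  edges may be parallel. The notions \<open>connected\<close>, \<open>forest\<close> and \<open>tree\<close> of Graph Theory are not
  used, because \<open>forest\<close> only excludes directed cycles.
\<close>

record ('v, 'e) ugraph =
  uverts :: "'v set"
  uedges :: "'e set"
  uends :: "'e \<Rightarrow> 'v set"

definition wf_ugraph :: "('v, 'e) ugraph \<Rightarrow> bool" where
  "wf_ugraph G \<longleftrightarrow> finite (uverts G) \<and> finite (uedges G) \<and>
     (\<forall>e \<in> uedges G. uends G e \<subseteq> uverts G \<and> card (uends G e) = 2)"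

definition ug_walk :: "('v, 'e) ugraph \<Rightarrow> 'v list \<Rightarrow> 'e list \<Rightarrow> bool" where
  "ug_walk G vs es \<longleftrightarrow> length vs = Suc (length es) \<and> set vs \<subseteq> uverts G \<and> set es \<subseteq> uedges G \<and>
     (\<forall>i < length es. uends G (es ! i) = {vs ! i, vs ! Suc i})"

definition ug_path :: "('v, 'e) ugraph \<Rightarrow> 'v \<Rightarrow> 'v list \<Rightarrow> 'e list \<Rightarrow> 'v \<Rightarrow> bool" where
  "ug_path G u vs es v \<longleftrightarrow> ug_walk G vs es \<and> distinct vs \<and> hd vs = u \<and> last vs = v"

text \<open>Two parallel edges form a cycle of length 2; hence the condition \<open>distinct es\<close>.\<close>

definition ug_cycle :: "('v, 'e) ugraph \<Rightarrow> 'v list \<Rightarrow> 'e list \<Rightarrow> bool" where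
  "ug_cycle G vs es \<longleftrightarrow> ug_walk G vs es \<and> es \<noteq> [] \<and> hd vs = last vs \<and>
     distinct (tl vs) \<and> distinct es"

definition ug_connected :: "('v, 'e) ugraph \<Rightarrow> bool" where
  "ug_connected G \<longleftrightarrow> uverts G \<noteq> {} \<and>
     (\<forall>u \<in> uverts G. \<forall>v \<in> uverts G. \<exists>vs es. ug_path G u vs es v)"

definition ug_tree :: "('v, 'e) ugraph \<Rightarrow> bool" where
  "ug_tree T \<longleftrightarrow> ug_connected T \<and> (\<nexists>vs es. ug_cycle T vs es)"

definition ug_subgraph :: "('v, 'e) ugraph \<Rightarrow> ('v, 'e) ugraph \<Rightarrow> bool" where
  "ug_subgraph H G \<longleftrightarrow> uverts H \<subseteq> uverts G \<and> uedges H \<subseteq> uedges G \<and> uends H = uends G \<and>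
     wf_ugraph G \<and> wf_ugraph H"

definition ug_induced :: "('v, 'e) ugraph \<Rightarrow> 'v set \<Rightarrow> ('v, 'e) ugraph" where
  "ug_induced G X = \<lparr>uverts = X, uedges = {e \<in> uedges G. uends G e \<subseteq> X}, uends = uends G\<rparr>"

text \<open>Counting incident edges is the degree because loops do not occur.\<close>

definition ug_degree :: "('v, 'e) ugraph \<Rightarrow> 'v \<Rightarrow> nat" where
  "ug_degree G v = card {e \<in> uedges G. v \<in> uends G e}"

definition ug_int :: "('v, 'e) ugraph \<Rightarrow> 'v set" where
  "ug_int T = {v \<in> uverts T. 2 \<le> ug_degree T v}"

definition ug_leaves :: "('v, 'e) ugraph \<Rightarrow> 'v set" where
  "ug_leaves T = uverts T - ug_int T"

definition steiner_tree :: "('v, 'e) ugraph \<Rightarrow> 'v set \<Rightarrow> ('v, 'e) ugraph \<Rightarrow> bool" where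
  "steiner_tree G R T \<longleftrightarrow> ug_subgraph T G \<and> ug_tree T \<and> R \<subseteq> uverts T \<and> ug_leaves T \<subseteq> R"

definition pendant :: "'v set \<Rightarrow> ('v, 'e) ugraph \<Rightarrow> bool" where
  "pendant R T \<longleftrightarrow> ug_leaves T = R"

definition non_pendant :: "'v set \<Rightarrow> ('v, 'e) ugraph \<Rightarrow> bool" where
  "non_pendant R T \<longleftrightarrow> ug_int T \<inter> R \<noteq> {}"

definition CIST :: "('v, 'e) ugraph \<Rightarrow> 'v set \<Rightarrow> nat \<Rightarrow> ('v, 'e) ugraph set \<Rightarrow> bool" where
  "CIST G R k \<T> \<longleftrightarrow> finite \<T> \<and> card \<T> = k \<and> (\<forall>T \<in> \<T>. steiner_tree G R T) \<and>
     (\<forall>u \<in> R. \<forall>v \<in> R. \<forall>T \<in> \<T>. \<forall>T' \<in> \<T>. u \<noteq> v \<longrightarrow> T \<noteq> T' \<longrightarrow>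
       (\<forall>vs es vs' es'. ug_path T u vs es v \<longrightarrow> ug_path T' u vs' es' v \<longrightarrow>
         set es \<inter> set es' = {} \<and> (set vs - {u, v}) \<inter> (set vs' - {u, v}) = {}))"

definition pendant_CIST :: "('v, 'e) ugraph \<Rightarrow> 'v set \<Rightarrow> nat \<Rightarrow> ('v, 'e) ugraph set \<Rightarrow> bool" where
  "pendant_CIST G R k \<T> \<longleftrightarrow> CIST G R k \<T> \<and> (\<forall>T \<in> \<T>. pendant R T)"

definition non_pendant_CIST :: "('v, 'e) ugraph \<Rightarrow> 'v set \<Rightarrow> nat \<Rightarrow> ('v, 'e) ugraph set \<Rightarrow> bool" where
  "non_pendant_CIST G R k \<T> \<longleftrightarrow> CIST G R k \<T> \<and> (\<forall>T \<in> \<T>. non_pendant R T)"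

definition minor_partition :: "('v, 'e) ugraph \<Rightarrow> 'v set \<Rightarrow> 'v set set \<Rightarrow> bool" where
  "minor_partition G R P \<longleftrightarrow> partition_on (uverts G) P \<and> card P = card R \<and>
     (\<forall>X \<in> P. card (X \<inter> R) = 1 \<and> ug_connected (ug_induced G X))"

text \<open>
  The arc named \<open>(X, e, Y)\<close> leads from \<open>X\<close> to \<open>Y\<close> and stems from the edge \<open>e\<close>. Distinct edges give
  distinct arcs, and an edge between two terminals gives two arcs.
\<close>

definition directed_minor ::
  "('v, 'e) ugraph \<Rightarrow> 'v set \<Rightarrow> 'v set set \<Rightarrow> ('v set, 'v set \<times> 'e \<times> 'v set) pre_digraph" where
  "directed_minor G R P =
     \<lparr>verts = P,
      arcs = {(X, e, Y). X \<in> P \<and> Y \<in> P \<and> X \<noteq> Y \<and> e \<in> uedges G \<and>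
                (\<exists>x \<in> X. \<exists>r \<in> Y \<inter> R. uends G e = {x, r})},
      tail = (\<lambda>(X, e, Y). X),
      head = (\<lambda>(X, e, Y). Y)\<rparr>"

definition is_directed_minor ::
  "('v, 'e) ugraph \<Rightarrow> 'v set \<Rightarrow> ('v set, 'v set \<times> 'e \<times> 'v set) pre_digraph \<Rightarrow> bool" where
  "is_directed_minor G R D \<longleftrightarrow> (\<exists>P. minor_partition G R P \<and> D = directed_minor G R P)"

definition underlying :: "('a, 'b) pre_digraph \<Rightarrow> ('a, 'b) ugraph" where
  "underlying D = \<lparr>uverts = verts D, uedges = arcs D, uends = (\<lambda>a. {tail D a, head D a})\<rparr>"

definition arborescence :: "('a, 'b) pre_digraph \<Rightarrow> bool" where
  "arborescence T \<longleftrightarrow> ug_tree (underlying T) \<and>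
     (\<exists>r \<in> verts T. in_degree T r = 0 \<and> (\<forall>v \<in> verts T - {r}. in_degree T v = 1))"

definition CISA :: "('a, 'b) pre_digraph \<Rightarrow> nat \<Rightarrow> ('a, 'b) pre_digraph set \<Rightarrow> bool" where
  "CISA D k \<T> \<longleftrightarrow> finite \<T> \<and> card \<T> = k \<and> (\<forall>T \<in> \<T>. spanning T D \<and> arborescence T) \<and>
     (\<forall>T \<in> \<T>. \<forall>T' \<in> \<T>. T \<noteq> T' \<longrightarrow>
       ug_int (underlying T) \<inter> ug_int (underlying T') = {} \<and> arcs T \<inter> arcs T' = {})"

end

theory Submission
  imports Defs
begin

text \<open>
  Deleting an edge or an inner vertex of a Steiner tree separates some pair of terminals. Two
  nontrivial partitions of a set always have a common separated pair, so the trees of a CIST are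
  pairwise edge-disjoint and have disjoint sets of inner vertices. Choose a terminal \<open>\<rho> T\<close> in
  each tree \<open>T\<close> such that the sets \<open>(int T \<inter> R) \<union> {\<rho> T}\<close> are pairwise disjoint: an inner
  terminal if the trees are non-pendant, any system of distinct terminals if they are pendant. Root
  \<open>T\<close> at \<open>\<rho> T\<close> and put each nonterminal of \<open>T\<close> into the part of its nearest terminal ancestor;
  every other vertex follows a shortest path to the union of the trees. In the resulting directed
  minor, the edges of \<open>T\<close> that enter a terminal from its parent form a spanning arborescence whose
  inner vertices are the parts of terminals in \<open>(int T \<inter> R) \<union> {\<rho> T}\<close>.
\<close>

section \<open>Adjacency, paths and bridges\<close>

text \<open>The edge set is kept apart from the incidence map: deleting an edge, or all edges at a
  vertex, only shrinks \<open>F\<close>, and separation becomes non-membership in a closure.\<close>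

definition adj :: "('e \<Rightarrow> 'v set) \<Rightarrow> 'e set \<Rightarrow> ('v \<times> 'v) set" where
  "adj ends F = {(a, b). \<exists>e \<in> F. ends e = {a, b}}"

lemma adjI: "e \<in> F \<Longrightarrow> ends e = {a, b} \<Longrightarrow> (a, b) \<in> adj ends F"
  by (auto simp: adj_def)

lemma reach_sym: "(a, b) \<in> (adj ends F)\<^sup>* \<Longrightarrow> (b, a) \<in> (adj ends F)\<^sup>*"
proof -
  have "sym (adj ends F)"
    by (auto simp: adj_def sym_def insert_commute)
  then show "(a, b) \<in> (adj ends F)\<^sup>* \<Longrightarrow> (b, a) \<in> (adj ends F)\<^sup>*"
    by (meson symD sym_rtrancl)
qed

lemma reach_mono: "(a, b) \<in> (adj ends F)\<^sup>* \<Longrightarrow> F \<subseteq> F' \<Longrightarrow> (a, b) \<in> (adj ends F')\<^sup>*"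
  by (rule set_mp[OF rtrancl_mono]) (auto simp: adj_def)

lemma ug_walk_reach:
  assumes "ug_walk H vs es" and "i \<le> length es"
  shows "(vs ! 0, vs ! i) \<in> (adj (uends H) (set es))\<^sup>*"
  using assms(2)
proof (induction i)
  case (Suc i)
  then have "(vs ! i, vs ! Suc i) \<in> adj (uends H) (set es)"
    using assms(1) by (intro adjI[of "es ! i"]) (auto simp: ug_walk_def)
  with Suc show ?case by (auto intro: rtrancl_into_rtrancl)
qed simp

lemma ug_path_reach:
  assumes "ug_path H u vs es v"
  shows "(u, v) \<in> (adj (uends H) (set es))\<^sup>*"
proof -
  have w: "ug_walk H vs es" and "hd vs = u" "last vs = v" using assms by (auto simp: ug_path_def)
  moreover have "vs \<noteq> []" "length vs = Suc (length es)" using w by (auto simp: ug_walk_def)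
  ultimately show ?thesis
    using ug_walk_reach[OF w, of "length es"] by (simp add: hd_conv_nth last_conv_nth)
qed

lemma ug_walk_Cons:
  assumes "ug_walk H vs es" and "hd vs = w" and "e \<in> uedges H" "uends H e = {u, w}" "u \<in> uverts H"
  shows "ug_walk H (u # vs) (e # es)"
proof -
  have "vs \<noteq> []" using assms(1) by (auto simp: ug_walk_def)
  then have "vs ! 0 = w" using assms(2) by (simp add: hd_conv_nth)
  then show ?thesis using assms by (auto simp: ug_walk_def nth_Cons split: nat.splits)
qed

lemma reach_ug_path:
  assumes "(u, v) \<in> (adj (uends H) F)\<^sup>*" and "F \<subseteq> uedges H"
    and "\<And>e. e \<in> F \<Longrightarrow> uends H e \<subseteq> uverts H" and "v \<in> uverts H"
  shows "\<exists>vs es. ug_path H u vs es v \<and> set es \<subseteq> F"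
  using assms(1)
proof (induction rule: converse_rtrancl_induct)
  case base
  have "ug_path H v [v] [] v" using assms(4) by (simp add: ug_path_def ug_walk_def)
  then show ?case by (metis empty_set empty_subsetI)
next
  case (step u w)
  from step(1) obtain e where e: "e \<in> F" "uends H e = {u, w}" by (auto simp: adj_def)
  from step(3) obtain vs es where p: "ug_path H w vs es v" "set es \<subseteq> F" by blast
  have w: "ug_walk H vs es" "distinct vs" "hd vs = w" "last vs = v" and ne: "vs \<noteq> []"
    and len: "length vs = Suc (length es)"
    using p(1) by (auto simp: ug_path_def ug_walk_def)
  show ?case
  proof (cases "u \<in> set vs")
    \<comment> \<open>\<open>u\<close> already lies on the path, so its suffix starting at
      \<open>u\<close> is taken and no vertex repeats.\<close>
    case True
    then obtain i where i: "i < length vs" "vs ! i = u" by (auto simp: in_set_conv_nth)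
    have "ug_walk H (drop i vs) (drop i es)"
      using w(1) i(1) set_drop_subset[of i vs] set_drop_subset[of i es]
      by (auto simp: ug_walk_def)
    then have "ug_path H u (drop i vs) (drop i es) v"
      using w i by (auto simp: ug_path_def hd_drop_conv_nth)
    moreover have "set (drop i es) \<subseteq> F" using p(2) set_drop_subset[of i es] by auto
    ultimately show ?thesis by blast
  next
    case False
    have "ug_walk H (u # vs) (e # es)"
      using ug_walk_Cons[OF w(1,3)] e assms(2,3) by (metis insert_subset subsetD)
    then have "ug_path H u (u # vs) (e # es) v"
      using w ne False by (auto simp: ug_path_def)
    then show ?thesis using e(1) p(2) by (metis insert_subset list.simps(15))
  qed
qed

text \<open>On a path with distinct vertices, the pair of ends of an edge determines its index. This
  supplies the edge distinctness that \<open>ug_cycle\<close> demands.\<close>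

lemma ug_path_distinct_edges:
  assumes "ug_path H u vs es v"
  shows "distinct es"
  unfolding distinct_conv_nth
proof (intro allI impI notI)
  fix i j assume ij: "i < length es" "j < length es" "i \<noteq> j" "es ! i = es ! j"
  have d: "distinct vs" "length vs = Suc (length es)"
    and ends: "\<And>i. i < length es \<Longrightarrow> uends H (es ! i) = {vs ! i, vs ! Suc i}"
    using assms by (auto simp: ug_path_def ug_walk_def)
  have "{vs ! i, vs ! Suc i} = {vs ! j, vs ! Suc j}" using ends ij by metis
  then have "(vs ! i = vs ! j) \<or> (vs ! i = vs ! Suc j \<and> vs ! Suc i = vs ! j)"
    by (auto simp: doubleton_eq_iff)
  then show False using ij d by (auto simp: nth_eq_iff_index_eq)
qed

text \<open>A path from \<open>x\<close> to \<open>y\<close> that avoids \<open>e\<close> would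
  close up with \<open>e\<close> to a cycle.\<close>

lemma acyclic_bridge:
  assumes acyc: "\<nexists>vs es. ug_cycle T vs es" and wf: "wf_ugraph T"
    and e: "e \<in> uedges T" "uends T e = {x, y}"
  shows "(x, y) \<notin> (adj (uends T) (uedges T - {e}))\<^sup>*"
proof
  assume r: "(x, y) \<in> (adj (uends T) (uedges T - {e}))\<^sup>*"
  have V: "\<And>f. f \<in> uedges T \<Longrightarrow> uends T f \<subseteq> uverts T" using wf by (auto simp: wf_ugraph_def)
  have y: "y \<in> uverts T" using V e by blast
  obtain vs es where p: "ug_path T x vs es y" "set es \<subseteq> uedges T - {e}"
    using reach_ug_path[OF r _ _ y] V by blast
  then have w: "ug_walk T vs es" "distinct vs" "hd vs = x" "last vs = y" "vs \<noteq> []"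
    by (auto simp: ug_path_def ug_walk_def)
  have "ug_walk T (y # vs) (e # es)"
    using ug_walk_Cons[OF w(1,3) e(1)] e(2) y by (simp add: insert_commute)
  then have "ug_cycle T (y # vs) (e # es)"
    using w p(2) ug_path_distinct_edges[OF p(1)] by (auto simp: ug_cycle_def)
  with acyc show False by blast
qed

lemma wf_ugraph_other_end:
  assumes "wf_ugraph H" "e \<in> uedges H" "x \<in> uends H e"
  obtains y where "uends H e = {x, y}" "x \<noteq> y"
proof -
  have "card (uends H e) = 2" using assms by (auto simp: wf_ugraph_def)
  then obtain a b where "uends H e = {a, b}" "a \<noteq> b" by (auto simp: card_2_iff)
  then show ?thesis using assms(3) that[of a] that[of b] by (auto simp: insert_commute)
qed

lemma ug_connected_reach:
  assumes "ug_connected H" "u \<in> uverts H" "v \<in> uverts H"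
  shows "(u, v) \<in> (adj (uends H) (uedges H))\<^sup>*"
proof -
  obtain vs es where p: "ug_path H u vs es v" using assms unfolding ug_connected_def by blast
  then have "set es \<subseteq> uedges H" by (auto simp: ug_path_def ug_walk_def)
  with ug_path_reach[OF p] show ?thesis by (rule reach_mono)
qed

section \<open>Steiner trees\<close>

text \<open>Walk away from \<open>e\<close> through \<open>y\<close>. If \<open>y\<close> is not a
  leaf, another edge \<open>e'\<close> leads to some \<open>z\<close>, and what \<open>z\<close>
  reaches without \<open>e'\<close> is a proper part of what \<open>y\<close> reaches without
  \<open>e\<close>. So the walk ends at a leaf.\<close>

lemma leaf_beyond_edge:
  assumes acyc: "\<nexists>vs es. ug_cycle T vs es" and wf: "wf_ugraph T" and L: "ug_leaves T \<subseteq> R"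
    and "e \<in> uedges T" "uends T e = {x, y}"
  shows "\<exists>u \<in> R. (y, u) \<in> (adj (uends T) (uedges T - {e}))\<^sup>*"
  using assms(4,5)
proof (induction "card {w. (y, w) \<in> (adj (uends T) (uedges T - {e}))\<^sup>*}" arbitrary: e x y
    rule: less_induct)
  case less
  let ?C = "\<lambda>y e. {w. (y, w) \<in> (adj (uends T) (uedges T - {e}))\<^sup>*}"
  have V: "\<And>f. f \<in> uedges T \<Longrightarrow> uends T f \<subseteq> uverts T" and fin: "finite (uverts T)"
    using wf by (auto simp: wf_ugraph_def)
  have y: "y \<in> uverts T" using V less.prems by blast
  show ?case
  proof (cases "y \<in> ug_leaves T")
    case True
    then show ?thesis using L by auto
  next
    case False
    then have "2 \<le> card {f \<in> uedges T. y \<in> uends T f}"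
      using y by (auto simp: ug_leaves_def ug_int_def ug_degree_def)
    then have "\<not> {f \<in> uedges T. y \<in> uends T f} \<subseteq> {e}"
      using card_mono[of "{e}" "{f \<in> uedges T. y \<in> uends T f}"] by auto
    then obtain e' where e': "e' \<in> uedges T" "y \<in> uends T e'" "e' \<noteq> e" by auto
    then obtain z where z: "uends T e' = {y, z}" "y \<noteq> z"
      using wf_ugraph_other_end[OF wf e'(1,2)] by blast
    have nb: "(z, y) \<notin> (adj (uends T) (uedges T - {e'}))\<^sup>*"
      using acyclic_bridge[OF acyc wf e'(1), of z y] z by (simp add: insert_commute)
    have yz: "(y, z) \<in> (adj (uends T) (uedges T - {e}))\<^sup>*"
      using e' z by (intro r_into_rtrancl adjI[of e']) auto
    \<comment> \<open>Using \<open>e\<close> would bring the walk to \<open>y\<close>, which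
      \<open>z\<close> cannot reach without the bridge \<open>e'\<close>.\<close>
    have sub: "(y, w) \<in> (adj (uends T) (uedges T - {e}))\<^sup>*"
      if "(z, w) \<in> (adj (uends T) (uedges T - {e'}))\<^sup>*" for w
      using that
    proof (induction rule: rtrancl_induct)
      case base
      show ?case by (fact yz)
    next
      case (step a b)
      have zb: "(z, b) \<in> (adj (uends T) (uedges T - {e'}))\<^sup>*"
        using step(1,2) by (rule rtrancl_into_rtrancl)
      obtain f where f: "f \<in> uedges T" "f \<noteq> e'" "uends T f = {a, b}"
        using step(2) by (auto simp: adj_def)
      have "f \<noteq> e"
        using less.prems f step(1) zb nb by (metis doubleton_eq_iff)
      then have "(a, b) \<in> adj (uends T) (uedges T - {e})" using f by (intro adjI[of f]) auto
      with step(3) show ?case by (rule rtrancl_into_rtrancl)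
    qed
    have fC: "?C y e \<subseteq> uverts T"
    proof
      fix w assume "w \<in> ?C y e"
      then have "(y, w) \<in> (adj (uends T) (uedges T - {e}))\<^sup>*" by simp
      then show "w \<in> uverts T"
        by (cases rule: rtranclE) (use y V in \<open>auto simp: adj_def\<close>)
    qed
    have "?C z e' \<subset> ?C y e" using sub nb by auto
    then have "card (?C z e') < card (?C y e)"
      by (rule psubset_card_mono[OF finite_subset[OF fC fin]])
    then obtain u where "u \<in> R" "(z, u) \<in> (adj (uends T) (uedges T - {e'}))\<^sup>*"
      using less.hyps[of z e' y] e'(1) z(1) by blast
    then show ?thesis using sub by blast
  qed
qed

context
  fixes G T :: "('v, 'e) ugraph" and R :: "'v set"
  assumes st: "steiner_tree G R T"
begin

lemma steiner_treeD:
  shows "wf_ugraph T" and "\<nexists>vs es. ug_cycle T vs es" and "ug_leaves T \<subseteq> R" and "ug_connected T"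
    and "R \<subseteq> uverts T" and "uends T = uends G" and "uedges T \<subseteq> uedges G" and "uverts T \<subseteq> uverts G"
  using st unfolding steiner_tree_def ug_tree_def ug_subgraph_def by blast+

text \<open>Take terminals beyond the two ends of \<open>e\<close>: a connection between them
  without \<open>e\<close> would join these ends, although \<open>e\<close> is a bridge.\<close>

lemma steiner_edge_separates:
  assumes e: "e \<in> uedges T"
  shows "\<exists>u \<in> R. \<exists>v \<in> R. (u, v) \<notin> (adj (uends G) (uedges T - {e}))\<^sup>*"
proof -
  obtain x y where xy: "uends T e = {x, y}"
    using steiner_treeD(1) e by (auto simp: wf_ugraph_def card_2_iff)
  obtain u where u: "u \<in> R" "(x, u) \<in> (adj (uends T) (uedges T - {e}))\<^sup>*"
    using leaf_beyond_edge[OF steiner_treeD(2,1,3) e, of y x] xy by (auto simp: insert_commute)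
  obtain v where v: "v \<in> R" "(y, v) \<in> (adj (uends T) (uedges T - {e}))\<^sup>*"
    using leaf_beyond_edge[OF steiner_treeD(2,1,3) e xy] by auto
  have "(u, v) \<notin> (adj (uends T) (uedges T - {e}))\<^sup>*"
    using acyclic_bridge[OF steiner_treeD(2,1) e xy] u(2) reach_sym[OF v(2)]
    by (meson rtrancl_trans)
  then show ?thesis using u v steiner_treeD(6) by metis
qed

text \<open>Two edges at \<open>x\<close> lead to terminals in different branches. Both differ from
  \<open>x\<close>, so \<open>x\<close> is an internal vertex of the path in \<open>T\<close>
  between them.\<close>

lemma steiner_int_separates:
  assumes x: "x \<in> ug_int T"
  shows "\<exists>u \<in> R - {x}. \<exists>v \<in> R - {x}.
    (u, v) \<notin> (adj (uends G) {e \<in> uedges T. x \<notin> uends G e})\<^sup>*"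
proof -
  let ?F = "{e \<in> uedges T. x \<notin> uends T e}"
  have "2 \<le> card {f \<in> uedges T. x \<in> uends T f}"
    using x by (simp add: ug_int_def ug_degree_def)
  then obtain B where "card B = 2" "B \<subseteq> {f \<in> uedges T. x \<in> uends T f}"
    by (meson obtain_subset_with_card_n)
  then obtain e1 e2 where e: "e1 \<in> uedges T" "e2 \<in> uedges T" "e1 \<noteq> e2"
      "x \<in> uends T e1" "x \<in> uends T e2" by (auto simp: card_2_iff)
  have beyond: "\<exists>y u. uends T e = {x, y} \<and> u \<in> R - {x} \<and> (y, u) \<in> (adj (uends T) ?F)\<^sup>*"
    if e: "e \<in> uedges T" "x \<in> uends T e" for e
  proof -
    obtain y where y: "uends T e = {x, y}"
      using wf_ugraph_other_end[OF steiner_treeD(1) e] by blast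
    obtain u where u: "u \<in> R" "(y, u) \<in> (adj (uends T) (uedges T - {e}))\<^sup>*"
      using leaf_beyond_edge[OF steiner_treeD(2,1,3) e(1) y] by auto
    have nb: "(y, x) \<notin> (adj (uends T) (uedges T - {e}))\<^sup>*"
      using acyclic_bridge[OF steiner_treeD(2,1) e(1), of y x] y by (simp add: insert_commute)
    \<comment> \<open>As \<open>e\<close> is a bridge, the walk from \<open>y\<close> never returns
      to \<open>x\<close> and hence uses no edge at \<open>x\<close>.\<close>
    have "(y, u) \<in> (adj (uends T) ?F)\<^sup>*"
      using u(2)
    proof (induction rule: rtrancl_induct)
      case (step a b)
      have yb: "(y, b) \<in> (adj (uends T) (uedges T - {e}))\<^sup>*"
        using step(1,2) by (rule rtrancl_into_rtrancl)
      obtain f where f: "f \<in> uedges T" "uends T f = {a, b}" using step(2) by (auto simp: adj_def)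
      have "(a, b) \<in> adj (uends T) ?F" using f nb yb step(1) by (intro adjI[of f]) auto
      with step(3) show ?case by (rule rtrancl_into_rtrancl)
    qed simp
    then show ?thesis using u nb y by blast
  qed
  obtain y1 u where 1: "uends T e1 = {x, y1}" "u \<in> R - {x}" "(y1, u) \<in> (adj (uends T) ?F)\<^sup>*"
    using beyond[OF e(1,4)] by blast
  obtain y2 v where 2: "uends T e2 = {x, y2}" "v \<in> R - {x}" "(y2, v) \<in> (adj (uends T) ?F)\<^sup>*"
    using beyond[OF e(2,5)] by blast
  \<comment> \<open>Otherwise \<open>y1\<close> reaches \<open>y2\<close> away from
    \<open>x\<close>, and \<open>e2\<close> then leads on to \<open>x\<close>, bypassing the bridge
    \<open>e1\<close>.\<close>
  have "(u, v) \<notin> (adj (uends T) ?F)\<^sup>*"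
  proof
    assume "(u, v) \<in> (adj (uends T) ?F)\<^sup>*"
    then have "(y1, y2) \<in> (adj (uends T) ?F)\<^sup>*"
      using 1(3) reach_sym[OF 2(3)] by (meson rtrancl_trans)
    then have "(y1, y2) \<in> (adj (uends T) (uedges T - {e1}))\<^sup>*"
      by (rule reach_mono) (use e(4) in auto)
    moreover have "(y2, x) \<in> adj (uends T) (uedges T - {e1})"
      using 2(1) e by (intro adjI[of e2]) auto
    ultimately have "(y1, x) \<in> (adj (uends T) (uedges T - {e1}))\<^sup>*"
      by (rule rtrancl_into_rtrancl)
    with acyclic_bridge[OF steiner_treeD(2,1) e(1), of y1 x] 1(1) show False
      by (simp add: insert_commute)
  qed
  then show ?thesis using 1(2) 2(2) unfolding steiner_treeD(6) by (intro bexI)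
qed

end

section \<open>Disjointness of the trees of a CIST\<close>

text \<open>Suppose every pair is in \<open>E1\<close> or \<open>E2\<close>. Then
  \<open>(c, d)\<close> is in \<open>E1\<close>. One of \<open>a\<close>, \<open>b\<close> is not
  \<open>E1\<close>-related to \<open>c\<close>, hence not to \<open>d\<close> either; so it is
  \<open>E2\<close>-related to both, which puts \<open>(c, d)\<close> into
  \<open>E2\<close>.\<close>

lemma common_separated_pair:
  assumes "sym E1" "trans E1" "sym E2" "trans E2"
    and "\<exists>a \<in> S. \<exists>b \<in> S. (a, b) \<notin> E1" and "\<exists>c \<in> S. \<exists>d \<in> S. (c, d) \<notin> E2"
  shows "\<exists>u \<in> S. \<exists>v \<in> S. (u, v) \<notin> E1 \<and> (u, v) \<notin> E2"
proof (rule ccontr)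
  assume neg: "\<not> ?thesis"
  obtain a b c d where ab: "a \<in> S" "b \<in> S" "(a, b) \<notin> E1" and cd: "c \<in> S" "d \<in> S" "(c, d) \<notin> E2"
    using assms(5,6) by blast
  have t: "\<And>u v. u \<in> S \<Longrightarrow> v \<in> S \<Longrightarrow> (u, v) \<in> E1 \<or> (u, v) \<in> E2" using neg by blast
  show False using assms(1-4) ab cd t[of a b] t[of c d] t[of a c] t[of a d] t[of b c] t[of b d]
    by (meson symD transD)
qed

lemma reach_sym_trans: "sym ((adj ends F)\<^sup>*)" "trans ((adj ends F)\<^sup>*)"
  by (auto intro: symI reach_sym trans_rtrancl)

text \<open>The condition in \<open>CIST\<close> compares only paths with the same two ends. A
  shared edge or inner vertex separates terminals in each tree, and
  \<open>common_separated_pair\<close> yields one pair for both trees, whose two paths then share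
  it.\<close>

lemma CIST_disjoint:
  assumes C: "CIST G R k \<T>" and T: "T \<in> \<T>" "T' \<in> \<T>" "T \<noteq> T'"
  shows "uedges T \<inter> uedges T' = {}" and "ug_int T \<inter> ug_int T' = {}"
proof -
  have S: "steiner_tree G R T" "steiner_tree G R T'" using C T by (auto simp: CIST_def)
  note st1 = steiner_treeD[OF S(1)] and st2 = steiner_treeD[OF S(2)]
  have paths: "\<exists>vs es vs' es'. ug_path T u vs es v \<and> ug_path T' u vs' es' v \<and>
      set es \<inter> set es' = {} \<and> (set vs - {u, v}) \<inter> (set vs' - {u, v}) = {}"
    if uv: "u \<in> R" "v \<in> R" "u \<noteq> v" for u v
  proof -
    obtain vs es where p1: "ug_path T u vs es v"
      using st1(4) subsetD[OF st1(5)] uv unfolding ug_connected_def by blast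
    obtain vs' es' where p2: "ug_path T' u vs' es' v"
      using st2(4) subsetD[OF st2(5)] uv unfolding ug_connected_def by blast
    have "\<forall>vs es vs' es'. ug_path T u vs es v \<longrightarrow> ug_path T' u vs' es' v \<longrightarrow>
        set es \<inter> set es' = {} \<and> (set vs - {u, v}) \<inter> (set vs' - {u, v}) = {}"
      using C T uv by (simp add: CIST_def)
    then have "set es \<inter> set es' = {} \<and> (set vs - {u, v}) \<inter> (set vs' - {u, v}) = {}"
      using p1 p2 by (elim allE impE)
    with p1 p2 show ?thesis by (intro exI conjI) auto
  qed
  have path_edge: "e \<in> set es"
    if "ug_path H u vs es v" "uends H = uends G" "(u, v) \<notin> (adj (uends G) (uedges H - {e}))\<^sup>*"
    for H e u v vs es
  proof (rule ccontr)
    assume "e \<notin> set es"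
    then have "set es \<subseteq> uedges H - {e}" using that(1) by (auto simp: ug_path_def ug_walk_def)
    then show False using reach_mono[OF ug_path_reach[OF that(1)]] that by metis
  qed
  have path_vertex: "x \<in> set vs"
    if "ug_path H u vs es v" "uends H = uends G"
      "(u, v) \<notin> (adj (uends G) {e \<in> uedges H. x \<notin> uends G e})\<^sup>*"
    for H x u v vs es
  proof (rule ccontr)
    assume x: "x \<notin> set vs"
    have "set es \<subseteq> {e \<in> uedges H. x \<notin> uends G e}"
    proof
      fix e assume "e \<in> set es"
      then obtain i where "i < length es" "es ! i = e" by (auto simp: in_set_conv_nth)
      then have "uends G e = {vs ! i, vs ! Suc i}" "i < length vs" "Suc i < length vs"
        using that by (auto simp: ug_path_def ug_walk_def)
      then have "x \<notin> uends G e" using x nth_mem by fastforce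
      then show "e \<in> {e \<in> uedges H. x \<notin> uends G e}"
        using \<open>e \<in> set es\<close> that(1) by (auto simp: ug_path_def ug_walk_def)
    qed
    then show False using reach_mono[OF ug_path_reach[OF that(1)]] that by metis
  qed
  show "uedges T \<inter> uedges T' = {}"
  proof (rule ccontr)
    assume "uedges T \<inter> uedges T' \<noteq> {}"
    then obtain e where e: "e \<in> uedges T" "e \<in> uedges T'" by auto
    obtain u v where uv: "u \<in> R" "v \<in> R"
        "(u, v) \<notin> (adj (uends G) (uedges T - {e}))\<^sup>*"
        "(u, v) \<notin> (adj (uends G) (uedges T' - {e}))\<^sup>*"
      using common_separated_pair[OF reach_sym_trans reach_sym_trans
        steiner_edge_separates[OF S(1) e(1)] steiner_edge_separates[OF S(2) e(2)]] by blast
    then have "u \<noteq> v" by auto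
    then obtain vs es vs' es' where p: "ug_path T u vs es v" "ug_path T' u vs' es' v"
      "set es \<inter> set es' = {}"
      using paths[OF uv(1,2)] by auto
    have "e \<in> set es" "e \<in> set es'"
      using path_edge[OF p(1) st1(6) uv(3)] path_edge[OF p(2) st2(6) uv(4)] by auto
    then show False using p(3) by auto
  qed
  show "ug_int T \<inter> ug_int T' = {}"
  proof (rule ccontr)
    assume "ug_int T \<inter> ug_int T' \<noteq> {}"
    then obtain x where x: "x \<in> ug_int T" "x \<in> ug_int T'" by auto
    obtain u v where uv: "u \<in> R - {x}" "v \<in> R - {x}"
        "(u, v) \<notin> (adj (uends G) {e \<in> uedges T. x \<notin> uends G e})\<^sup>*"
        "(u, v) \<notin> (adj (uends G) {e \<in> uedges T'. x \<notin> uends G e})\<^sup>*"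
      using common_separated_pair[OF reach_sym_trans reach_sym_trans
        steiner_int_separates[OF S(1) x(1)] steiner_int_separates[OF S(2) x(2)]] by blast
    then have ne: "u \<noteq> v" by auto
    obtain vs es vs' es' where p: "ug_path T u vs es v" "ug_path T' u vs' es' v"
      "(set vs - {u, v}) \<inter> (set vs' - {u, v}) = {}"
      using paths[of u v] uv ne by auto
    have "x \<in> set vs" "x \<in> set vs'"
      using path_vertex[OF p(1) st1(6) uv(3)] path_vertex[OF p(2) st2(6) uv(4)] by auto
    then show False using p(3) uv(1,2) by auto
  qed
qed

section \<open>Retractions along parent functions\<close>

text \<open>A spanning forest rooted at \<open>S\<close>. The map \<open>e\<close> selects one of
  possibly parallel edges to the parent, and the rank \<open>d\<close> guarantees that climbing ends
  in \<open>S\<close>.\<close>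

definition parent_fun ::
  "('v, 'e) ugraph \<Rightarrow> 'v set \<Rightarrow> ('v \<Rightarrow> 'v) \<Rightarrow> ('v \<Rightarrow> 'e) \<Rightarrow> ('v \<Rightarrow> nat) \<Rightarrow> bool" where
  "parent_fun H S p e d \<longleftrightarrow> (\<forall>v \<in> uverts H - S. p v \<in> uverts H \<and> e v \<in> uedges H \<and>
     uends H (e v) = {p v, v} \<and> d (p v) < d v)"

text \<open>Breadth-first search: the rank is the distance from \<open>S\<close>, and the parent is
  the last but one vertex of a shortest walk.\<close>

lemma ex_parent_fun:
  assumes con: "ug_connected H" and wf: "wf_ugraph H" and S: "S \<subseteq> uverts H" "S \<noteq> {}"
  shows "\<exists>p e d. parent_fun H S p e d"
proof -
  let ?A = "adj (uends H) (uedges H)"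
  define d where "d v = (LEAST n. \<exists>s \<in> S. (s, v) \<in> ?A ^^ n)" for v
  have "\<exists>w f. w \<in> uverts H \<and> f \<in> uedges H \<and> uends H f = {w, v} \<and> d w < d v"
    if v: "v \<in> uverts H - S" for v
  proof -
    obtain s where s: "s \<in> S" using S by auto
    then have "(s, v) \<in> ?A\<^sup>*" using ug_connected_reach[OF con] S v by blast
    then have "\<exists>n. \<exists>s \<in> S. (s, v) \<in> ?A ^^ n" using s by (auto simp: rtrancl_power)
    then have "\<exists>s \<in> S. (s, v) \<in> ?A ^^ d v" unfolding d_def by (rule LeastI_ex)
    then obtain s where s: "s \<in> S" "(s, v) \<in> ?A ^^ d v" by blast
    then have "d v \<noteq> 0" using v by (auto intro: gr0I)
    then obtain n where n: "d v = Suc n" using not0_implies_Suc by blast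
    then obtain w where w: "(s, w) \<in> ?A ^^ n" "(w, v) \<in> ?A" using s(2) by auto
    then obtain f where f: "f \<in> uedges H" "uends H f = {w, v}" by (auto simp: adj_def)
    have "d w \<le> n" unfolding d_def by (rule Least_le) (use s(1) w(1) in blast)
    moreover have "w \<in> uverts H" using f wf by (auto simp: wf_ugraph_def)
    ultimately show ?thesis using n f by (metis le_imp_less_Suc)
  qed
  then show ?thesis unfolding parent_fun_def by metis
qed

text \<open>The nearest ancestor of \<open>x\<close> in \<open>S\<close>, where \<open>x\<close>
  counts as its own ancestor. \<open>S\<close> may be larger than the root set of \<open>p\<close>:
  a tree is rooted at one terminal, but climbing stops at the first terminal met.\<close>

definition retract :: "('v \<Rightarrow> 'v) \<Rightarrow> 'v set \<Rightarrow> 'v \<Rightarrow> 'v" where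
  "retract p S x = (p ^^ (LEAST n. (p ^^ n) x \<in> S)) x"

lemma retract_id [simp]: "x \<in> S \<Longrightarrow> retract p S x = x"
proof -
  assume "x \<in> S"
  then have "(LEAST n. (p ^^ n) x \<in> S) = 0" by (intro Least_eq_0) simp
  then show ?thesis by (simp add: retract_def)
qed

context
  fixes H :: "('v, 'e) ugraph" and S S' :: "'v set" and p e d
  assumes pf: "parent_fun H S p e d" and SS: "S \<subseteq> S'"
begin

lemma parent_funD:
  assumes "v \<in> uverts H" "v \<notin> S"
  shows "p v \<in> uverts H" "e v \<in> uedges H" "uends H (e v) = {p v, v}" "d (p v) < d v"
  using pf assms by (auto simp: parent_fun_def)

lemma parent_induct [consumes 1, case_names base step]:
  assumes "x \<in> uverts H"
    and "\<And>x. x \<in> uverts H \<Longrightarrow> x \<in> S' \<Longrightarrow> P x"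
    and "\<And>x. x \<in> uverts H \<Longrightarrow> x \<notin> S' \<Longrightarrow> p x \<in> uverts H \<Longrightarrow> P (p x) \<Longrightarrow> P x"
  shows "P x"
  using assms(1)
proof (induction "d x" arbitrary: x rule: less_induct)
  case less
  show ?case
  proof (cases "x \<in> S'")
    case False
    then have "x \<notin> S" using SS by auto
    then show ?thesis using less assms(3) False parent_funD by blast
  qed (use less assms(2) in blast)
qed

lemma retract_step:
  assumes "x \<in> uverts H" "x \<notin> S'"
  shows "retract p S' x = retract p S' (p x)"
proof -
  have "\<exists>n. (p ^^ n) x \<in> S'" using assms(1)
  proof (induction rule: parent_induct)
    case (base x)
    then show ?case by (intro exI[of _ 0]) simp
  next
    case (step x)
    then obtain n where "(p ^^ n) (p x) \<in> S'" by blast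
    then have "(p ^^ Suc n) x \<in> S'" by (simp add: funpow_swap1)
    then show ?case by blast
  qed
  then obtain n where "(p ^^ n) x \<in> S'" by blast
  then have "(LEAST n. (p ^^ n) x \<in> S') = Suc (LEAST n. (p ^^ Suc n) x \<in> S')"
    using assms(2) by (intro Least_Suc) auto
  then show ?thesis by (simp add: retract_def funpow_swap1)
qed

text \<open>One induction along parents gives all four facts. The rank bound will make ranks grow
  along arcs, the child \<open>w\<close> will bound degrees from below, and the walk inside the
  fibre will make the parts connected.\<close>

lemma retract_props:
  assumes "x \<in> uverts H"
  shows "retract p S' x \<in> S' \<inter> uverts H \<and> d (retract p S' x) \<le> d x \<and>
    (retract p S' x = x \<or> (\<exists>w \<in> uverts H - S. p w = retract p S' x)) \<and>
    (x, retract p S' x) \<in> (adj (uends H) {f \<in> uedges H. uends H f \<subseteq>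
      {y \<in> uverts H. retract p S' y = retract p S' x}})\<^sup>*"
  using assms
proof (induction rule: parent_induct)
  case (step x)
  have xS: "x \<notin> S" using step SS by auto
  note r = retract_step[OF step(1,2)] and q = parent_funD[OF step(1) xS]
  have "(x, p x) \<in> adj (uends H) {f \<in> uedges H. uends H f \<subseteq>
      {y \<in> uverts H. retract p S' y = retract p S' (p x)}}"
    using q step(1) r by (intro adjI[of "e x"]) auto
  then have "(x, retract p S' (p x)) \<in> (adj (uends H) {f \<in> uedges H. uends H f \<subseteq>
      {y \<in> uverts H. retract p S' y = retract p S' (p x)}})\<^sup>*"
    using step(4) by (meson converse_rtrancl_into_rtrancl)
  moreover have "d (retract p S' (p x)) \<le> d x" using step(4) q(4) by linarith
  moreover have "\<exists>w \<in> uverts H - S. p w = retract p S' (p x)"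
    using step(1,4) xS by (metis DiffI)
  ultimately show ?case using step(4) unfolding r by blast
qed simp

end

section \<open>Recognising arborescences\<close>

text \<open>Following entering arcs backwards lowers the rank and so ends at \<open>r\<close>, which
  gives connectedness. The rank also excludes undirected cycles, by a look at a vertex of maximal
  rank.\<close>

lemma arborescence_rankI:
  fixes A :: "('a, 'b) pre_digraph" and rank :: "'a \<Rightarrow> nat"
  assumes wf: "wf_digraph A" and r: "r \<in> verts A"
    and root: "\<And>a. a \<in> arcs A \<Longrightarrow> head A a \<noteq> r"
    and ex1: "\<And>v. v \<in> verts A \<Longrightarrow> v \<noteq> r \<Longrightarrow> \<exists>!a. a \<in> arcs A \<and> head A a = v"
    and rank: "\<And>a. a \<in> arcs A \<Longrightarrow> rank (tail A a) < rank (head A a)"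
  shows "arborescence A"
proof -
  let ?U = "underlying A"
  have sel: "uverts ?U = verts A" "uedges ?U = arcs A" "\<And>a. uends ?U a = {tail A a, head A a}"
    by (auto simp: underlying_def)
  have inv: "in_arcs A v = {a. a \<in> arcs A \<and> head A a = v}" for v by (simp add: in_arcs_def)
  have "in_degree A r = 0" using root by (auto simp: in_degree_def inv intro: card_eq_0_iff[THEN iffD2])
  moreover have "in_degree A v = 1" if "v \<in> verts A - {r}" for v
    using ex1[of v] that by (auto simp: in_degree_def inv card_1_singleton_iff)
  moreover have "ug_connected ?U"
  proof -
    have reach: "(r, v) \<in> (adj (uends ?U) (uedges ?U))\<^sup>*" if "v \<in> verts A" for v
      using that
    proof (induction "rank v" arbitrary: v rule: less_induct)
      case less
      show ?case
      proof (cases "v = r")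
        case False
        then obtain a where a: "a \<in> arcs A" "head A a = v" using ex1 less by blast
        have "(r, tail A a) \<in> (adj (uends ?U) (uedges ?U))\<^sup>*"
          using less a rank[OF a(1)] wf by (auto simp: wf_digraph_def)
        moreover have "(tail A a, v) \<in> adj (uends ?U) (uedges ?U)"
          using a by (intro adjI[of a]) (auto simp: sel)
        ultimately show ?thesis by (rule rtrancl_into_rtrancl)
      qed simp
    qed
    have "\<exists>vs es. ug_path ?U u vs es v" if "u \<in> verts A" "v \<in> verts A" for u v
    proof -
      have uv: "(u, v) \<in> (adj (uends ?U) (uedges ?U))\<^sup>*"
        using reach_sym[OF reach[OF that(1)]] reach[OF that(2)] by (rule rtrancl_trans)
      show ?thesis
        using reach_ug_path[OF uv order_refl] that wf by (auto simp: sel wf_digraph_def)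
    qed
    then show ?thesis using r by (auto simp: ug_connected_def sel)
  qed
  moreover have "\<not> ug_cycle ?U vs es" for vs es
  proof
    assume c: "ug_cycle ?U vs es"
    then have len: "length vs = Suc (length es)" and ne: "es \<noteq> []" and dist: "distinct es"
      and arcs: "\<And>i. i < length es \<Longrightarrow> es ! i \<in> arcs A"
      and ends: "\<And>i. i < length es \<Longrightarrow> {tail A (es ! i), head A (es ! i)} = {vs ! i, vs ! Suc i}"
      and hl: "hd vs = last vs"
      by (auto simp: ug_cycle_def ug_walk_def sel)
    let ?n = "length es"
    have n: "0 < ?n" using ne by simp
    have loop: "vs ! 0 = vs ! ?n"
    proof -
      have "vs \<noteq> []" using len by auto
      then show ?thesis using hl len by (simp add: hd_conv_nth last_conv_nth)
    qed
    have n2: "1 < ?n"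
    proof (rule ccontr)
      assume "\<not> 1 < ?n"
      with n have "?n = 1" by linarith
      then show False using ends[of 0] loop rank[OF arcs[of 0]] by (auto simp: doubleton_eq_iff)
    qed
    \<comment> \<open>The two cycle edges at a vertex of maximal rank both enter it, so they coincide.\<close>
    define m where "m = Max ((\<lambda>i. rank (vs ! i)) ` {..<?n})"
    have "m \<in> (\<lambda>i. rank (vs ! i)) ` {..<?n}" unfolding m_def using n by (intro Max_in) auto
    then obtain i where i: "i < ?n" "rank (vs ! i) = m" by auto
    have max': "rank (vs ! j) \<le> m" if "j < ?n" for j unfolding m_def using that by auto
    have max: "rank (vs ! j) \<le> rank (vs ! i)" if "j \<le> ?n" for j
      using max'[of j] max'[of 0] n that loop i(2) by (cases "j = ?n") auto
    have enter: "head A (es ! j) = vs ! i" if "j < ?n" "vs ! i \<in> {vs ! j, vs ! Suc j}" for j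
      using ends[OF that(1)] that rank[OF arcs[OF that(1)]] max[of j] max[of "Suc j"]
      by (auto simp: doubleton_eq_iff)
    \<comment> \<open>The cycle edge before position \<open>i\<close>, cyclically; it differs from
      edge \<open>i\<close> because the cycle has length at least 2.\<close>
    define j where "j = (if i = 0 then ?n - 1 else i - 1)"
    have j: "j < ?n" "j \<noteq> i" "vs ! Suc j = vs ! i" using i n n2 loop by (auto simp: j_def)
    have h: "head A (es ! i) = vs ! i" "head A (es ! j) = vs ! i"
      using enter[of i] enter[of j] i j by auto
    moreover have "vs ! i \<in> verts A" using h(1) arcs[OF i(1)] wf by (metis wf_digraph.head_in_verts)
    moreover have "vs ! i \<noteq> r" using h(1) root arcs[OF i(1)] by metis
    ultimately have "es ! i = es ! j" using ex1 arcs i(1) j(1) by metis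
    then show False using dist i j by (simp add: nth_eq_iff_index_eq)
  qed
  ultimately show ?thesis using r by (auto simp: arborescence_def ug_tree_def)
qed

section \<open>The directed minor\<close>

text \<open>The common part of both cases, which differ only in the choice of the roots
  \<open>\<rho> T\<close>. Parts that are inner in an arborescence will belong to terminals in the
  sets assumed disjoint.\<close>

lemma CIST_imp_CISA:
  fixes G :: "('v, 'e) ugraph" and \<rho> :: "('v, 'e) ugraph \<Rightarrow> 'v"
  assumes wf: "wf_ugraph G" and con: "ug_connected G"
    and RG: "R \<subseteq> uverts G" and R2: "card R \<ge> 2" and C: "CIST G R k \<T>"
    and \<rho>: "\<And>T. T \<in> \<T> \<Longrightarrow> \<rho> T \<in> R"
    and disj: "\<And>T T'. T \<in> \<T> \<Longrightarrow> T' \<in> \<T> \<Longrightarrow> T \<noteq> T' \<Longrightarrow>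
      (ug_int T \<inter> R \<union> {\<rho> T}) \<inter> (ug_int T' \<inter> R \<union> {\<rho> T'}) = {}"
  shows "\<exists>D. is_directed_minor G R D \<and> (\<exists>\<A>. CISA D k \<A>)"
proof -
  have R0: "R \<noteq> {}" using R2 by auto
  have S: "steiner_tree G R T" if "T \<in> \<T>" for T using C that by (auto simp: CIST_def)
  note stD = steiner_treeD[OF S]
  have "\<exists>p e d. parent_fun T {\<rho> T} p e d" if "T \<in> \<T>" for T
    using ex_parent_fun[OF stD(4,1)] stD(5) \<rho> that by (metis empty_subsetI insert_not_empty insert_subset subsetD)
  then obtain p e d where pf: "\<And>T. T \<in> \<T> \<Longrightarrow> parent_fun T {\<rho> T} (p T) (e T) (d T)"
    by metis
  have \<rho>R: "{\<rho> T} \<subseteq> R" if "T \<in> \<T>" for T using \<rho> that by auto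
  note pD = parent_funD[OF pf \<rho>R, simplified]
  note rp = retract_props[OF pf \<rho>R]
  \<comment> \<open>Including \<open>R\<close> keeps \<open>U\<close> nonempty even if
    \<open>\<T>\<close> is empty.\<close>
  define U where "U = R \<union> (\<Union>T \<in> \<T>. uverts T)"
  have U: "U \<subseteq> uverts G" "U \<noteq> {}" using RG R0 stD(8) by (auto simp: U_def)
  obtain q f h where q: "parent_fun G U q f h" using ex_parent_fun[OF con wf U] by blast
  note rq = retract_props[OF q order_refl]
  \<comment> \<open>A nonterminal of a tree is inner there, so by \<open>CIST_disjoint\<close> it
    lies in only one tree and the choice is forced. Terminals lie in all trees and are treated
    separately.\<close>
  define lU where "lU x = (if x \<in> R then x else retract (p (SOME T. T \<in> \<T> \<and> x \<in> uverts T)) R x)" for x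
  have lU: "lU x = retract (p T) R x" if T: "T \<in> \<T>" "x \<in> uverts T" for T x
  proof (cases "x \<in> R")
    case False
    let ?T = "SOME T. T \<in> \<T> \<and> x \<in> uverts T"
    have T': "?T \<in> \<T> \<and> x \<in> uverts ?T" by (rule someI[of _ T]) (use T in blast)
    have "x \<in> ug_int T" "x \<in> ug_int ?T"
      using stD(3)[OF T(1)] stD(3)[of ?T] T T' False by (auto simp: ug_leaves_def)
    then have "?T = T" using CIST_disjoint(2)[OF C] T(1) T' by (metis disjoint_iff)
    then show ?thesis using False by (simp add: lU_def)
  qed (simp add: lU_def)
  define l where "l x = lU (retract q U x)" for x
  have lT: "l x = retract (p T) R x" if "T \<in> \<T>" "x \<in> uverts T" for T x
  proof -
    have "x \<in> U" using that by (auto simp: U_def)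
    then show ?thesis using lU that by (simp add: l_def)
  qed
  have lR: "l r = r" if "r \<in> R" for r using that by (simp add: l_def U_def lU_def)
  have lq: "l (retract q U x) = l x" if "x \<in> uverts G" for x
    using rq[OF that] by (simp add: l_def)
  \<comment> \<open>The fibres of \<open>l\<close> will be the parts. A walk to the terminal of the
    fibre has two legs, first to \<open>U\<close> and then up a tree; the fibres of both retractions
    lie inside those of \<open>l\<close>.\<close>
  have reach_l: "l x \<in> R \<and> (x, l x) \<in> (adj (uends G) {g \<in> uedges G. uends G g \<subseteq>
      {y \<in> uverts G. l y = l x}})\<^sup>*" if x: "x \<in> uverts G" for x
  proof -
    let ?A = "adj (uends G) {g \<in> uedges G. uends G g \<subseteq> {y \<in> uverts G. l y = l x}}"
    let ?y = "retract q U x"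
    have y: "?y \<in> U" using rq[OF x] by auto
    have 1: "(x, ?y) \<in> ?A\<^sup>*"
    proof -
      have "{y \<in> uverts G. retract q U y = ?y} \<subseteq> {y \<in> uverts G. l y = l x}"
        by (auto simp: l_def)
      then show ?thesis using rq[OF x] by (elim conjE reach_mono) blast
    qed
    have 2: "l ?y \<in> R \<and> (?y, l ?y) \<in> ?A\<^sup>*"
    proof (cases "?y \<in> R")
      case False
      then obtain T where T: "T \<in> \<T>" "?y \<in> uverts T" using y by (auto simp: U_def)
      have "{y \<in> uverts T. retract (p T) R y = retract (p T) R ?y} \<subseteq> {y \<in> uverts G. l y = l x}"
        using lT[OF T(1)] T(2) stD(8)[OF T(1)] lq[OF x] by auto
      then have sub: "{g \<in> uedges T. uends G g \<subseteq> {y \<in> uverts T. retract (p T) R y = retract (p T) R ?y}}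
          \<subseteq> {g \<in> uedges G. uends G g \<subseteq> {y \<in> uverts G. l y = l x}}"
        using stD(7)[OF T(1)] by blast
      have "(?y, retract (p T) R ?y) \<in> ?A\<^sup>*"
        using rp[OF T(1) T] unfolding stD(6)[OF T(1)] by (elim conjE reach_mono[OF _ sub])
      then show ?thesis using rp[OF T(1) T] lT[OF T] by simp
    qed (simp add: lR)
    show ?thesis using rtrancl_trans[OF 1 conjunct2[OF 2]] conjunct1[OF 2] by (simp only: lq[OF x] simp_thms)
  qed
  define V where "V r = {x \<in> uverts G. l x = r}" for r
  have Vr: "r \<in> V r" if "r \<in> R" for r using that RG lR by (auto simp: V_def)
  have VR: "V r \<inter> R = {r}" if "r \<in> R" for r using that RG lR by (auto simp: V_def)
  have V_eq: "r = s" if "V r = V s" "r \<in> R" "s \<in> R" for r s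
    using that VR by (metis singleton_inject)
  have injV: "inj_on V R" using V_eq by (rule inj_onI)
  define P where "P = V ` R"
  have mp: "minor_partition G R P"
    unfolding minor_partition_def
  proof (intro conjI ballI)
    show "partition_on (uverts G) P"
    proof (rule partition_onI)
      show "\<Union> P = uverts G" using reach_l by (auto simp: P_def V_def)
      show "{} \<notin> P" using Vr by (auto simp: P_def)
      show "disjnt X Y" if "X \<in> P" "Y \<in> P" "X \<noteq> Y" for X Y
        using that by (auto simp: P_def V_def disjnt_def)
    qed
    show "card P = card R" by (simp add: P_def card_image injV)
    fix X assume "X \<in> P"
    then obtain r where r: "r \<in> R" "X = V r" by (auto simp: P_def)
    show "card (X \<inter> R) = 1" using VR r by simp
    let ?H = "ug_induced G X"
    have sel: "uverts ?H = X" "uends ?H = uends G" "uedges ?H = {g \<in> uedges G. uends G g \<subseteq> X}"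
      by (auto simp: ug_induced_def)
    have reach: "(x, r) \<in> (adj (uends ?H) (uedges ?H))\<^sup>*" if "x \<in> X" for x
    proof -
      have "x \<in> uverts G" "l x = r" using that r by (auto simp: V_def)
      then show ?thesis using reach_l[of x] r(2) unfolding sel V_def by simp
    qed
    have "\<exists>vs es. ug_path ?H x vs es y" if "x \<in> X" "y \<in> X" for x y
    proof -
      have xy: "(x, y) \<in> (adj (uends ?H) (uedges ?H))\<^sup>*"
        using reach[OF that(1)] reach_sym[OF reach[OF that(2)]] by (rule rtrancl_trans)
      show ?thesis using reach_ug_path[OF xy order_refl] that by (auto simp: sel)
    qed
    then show "ug_connected ?H" using Vr r unfolding ug_connected_def sel by blast
  qed
  define D where "D = directed_minor G R P"
  have Dsel: "verts D = P" "tail D = (\<lambda>(X, e, Y). X)" "head D = (\<lambda>(X, e, Y). Y)"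
    by (auto simp: D_def directed_minor_def)
  have wfD: "wf_digraph D" by unfold_locales (auto simp: D_def directed_minor_def)
  \<comment> \<open>The parent edge of \<open>s\<close> ends at the terminal \<open>s\<close>, so it
    gives an arc from the part of the parent into the part of \<open>s\<close>.\<close>
  define arc where "arc T s = (V (l (p T s)), e T s, V s)" for T s
  define A where "A T = D\<lparr>arcs := arc T ` (R - {\<rho> T})\<rparr>" for T
  have Asel: "verts (A T) = P" "arcs (A T) = arc T ` (R - {\<rho> T})"
      "tail (A T) = (\<lambda>(X, e, Y). X)" "head (A T) = (\<lambda>(X, e, Y). Y)" for T
    by (simp_all add: A_def Dsel)
  have parent: "p T s \<in> uverts T" "e T s \<in> uedges T" "uends G (e T s) = {p T s, s}"
      "l (p T s) \<in> R" "d T (l (p T s)) < d T s"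
      "l (p T s) = p T s \<or> (\<exists>w \<in> uverts T - {\<rho> T}. p T w = l (p T s))"
    if T: "T \<in> \<T>" and s: "s \<in> R - {\<rho> T}" for T s
  proof -
    have sT: "s \<in> uverts T" "s \<noteq> \<rho> T" using s stD(5)[OF T] by auto
    show 1: "p T s \<in> uverts T" "e T s \<in> uedges T" "uends G (e T s) = {p T s, s}"
      using pD[OF T T sT] stD(6)[OF T] by auto
    show "l (p T s) \<in> R" "d T (l (p T s)) < d T s"
      "l (p T s) = p T s \<or> (\<exists>w \<in> uverts T - {\<rho> T}. p T w = l (p T s))"
      using rp[OF T T 1(1)] pD(4)[OF T T sT] lT[OF T 1(1)] by auto
  qed
  have arcD: "arc T s \<in> arcs D" if T: "T \<in> \<T>" and s: "s \<in> R - {\<rho> T}" for T s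
  proof -
    note par = parent[OF T s]
    have "V (l (p T s)) \<noteq> V s" using V_eq[OF _ par(4), of s] par(5) s by (metis DiffD1 less_irrefl)
    moreover have "p T s \<in> V (l (p T s))" using par(1) stD(8)[OF T] by (auto simp: V_def)
    moreover have "s \<in> V s \<inter> R" using s Vr by auto
    ultimately show ?thesis
      using par s stD(7)[OF T] by (auto simp: D_def directed_minor_def arc_def P_def)
  qed
  have wfA: "wf_digraph (A T)" if "T \<in> \<T>" for T
    using parent(4)[OF that] by unfold_locales (auto simp: Asel arc_def P_def)
  have span: "spanning (A T) D" if "T \<in> \<T>" for T
  proof -
    have "arcs (A T) \<subseteq> arcs D" using arcD[OF that] unfolding Asel by blast
    then show ?thesis
      using wfA[OF that] wfD by (simp add: spanning_def subgraph_def compatible_def Asel Dsel)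
  qed
  \<comment> \<open>The rank of a part is the rank in \<open>T\<close> of its terminal, recovered by
    \<open>inv_into\<close>. Each part other than the root is entered by exactly the arc of its
    terminal.\<close>
  have arb: "arborescence (A T)" if T: "T \<in> \<T>" for T
  proof (rule arborescence_rankI[where r = "V (\<rho> T)" and rank = "\<lambda>X. d T (inv_into R V X)"])
    show "wf_digraph (A T)" by (rule wfA[OF T])
    show "V (\<rho> T) \<in> verts (A T)" using \<rho>[OF T] by (auto simp: Asel P_def)
    show "head (A T) a \<noteq> V (\<rho> T)" if "a \<in> arcs (A T)" for a
      using that V_eq \<rho>[OF T] by (auto simp: Asel arc_def)
    show "\<exists>!a. a \<in> arcs (A T) \<and> head (A T) a = X"
      if X: "X \<in> verts (A T)" "X \<noteq> V (\<rho> T)" for X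
    proof -
      obtain s where s: "s \<in> R - {\<rho> T}" "X = V s" using X by (auto simp: Asel P_def)
      show ?thesis
        using s V_eq by (intro ex1I[of _ "arc T s"]) (auto simp: Asel arc_def)
    qed
    show "d T (inv_into R V (tail (A T) a)) < d T (inv_into R V (head (A T) a))"
      if a: "a \<in> arcs (A T)" for a
    proof -
      obtain s where s: "s \<in> R - {\<rho> T}" "a = arc T s" using a by (auto simp: Asel)
      then show ?thesis using parent(4,5)[OF T s(1)] injV by (simp add: Asel arc_def)
    qed
  qed
  \<comment> \<open>Unless \<open>s\<close> is the root, a second arc at its part must leave it,
    towards some \<open>V t\<close>. Then \<open>s\<close> is the nearest terminal above
    \<open>t\<close>, so it has a child \<open>w\<close> in \<open>T\<close> besides its parent
    edge.\<close>
  have int: "ug_int (underlying (A T)) \<subseteq> V ` (ug_int T \<inter> R \<union> {\<rho> T})" if T: "T \<in> \<T>" for T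
  proof
    fix X assume X: "X \<in> ug_int (underlying (A T))"
    then obtain s where s: "s \<in> R" "X = V s"
      by (auto simp: ug_int_def underlying_def Asel P_def)
    have deg: "2 \<le> card {a \<in> arcs (A T). X \<in> {tail (A T) a, head (A T) a}}"
      using X by (simp add: ug_int_def ug_degree_def underlying_def)
    show "X \<in> V ` (ug_int T \<inter> R \<union> {\<rho> T})"
    proof (cases "s = \<rho> T")
      case False
      have "\<not> {a \<in> arcs (A T). X \<in> {tail (A T) a, head (A T) a}} \<subseteq> {arc T s}"
      proof
        assume "{a \<in> arcs (A T). X \<in> {tail (A T) a, head (A T) a}} \<subseteq> {arc T s}"
        from card_mono[OF _ this] deg show False by simp
      qed
      then obtain t where t: "t \<in> R - {\<rho> T}" "t \<noteq> s" "X \<in> {V (l (p T t)), V t}"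
        by (auto simp: Asel arc_def)
      then have lt: "l (p T t) = s" using V_eq s parent(4)[OF T t(1)] by auto
      have "t \<in> uverts T - {\<rho> T}" using t(1) stD(5)[OF T] by auto
      then obtain w where w: "w \<in> uverts T" "w \<noteq> \<rho> T" "p T w = s"
        using parent(6)[OF T t(1)] unfolding lt by (metis DiffE singletonI)
      have sT: "s \<in> uverts T" using s stD(5)[OF T] by auto
      note es = pD[OF T T sT False] and ew = pD[OF T T w(1,2)]
      \<comment> \<open>The other end has smaller rank than \<open>s\<close> for one edge and larger
        rank for the other.\<close>
      have "e T s \<noteq> e T w" using es(3,4) ew(3,4) w(3) by (auto simp: doubleton_eq_iff)
      moreover have "{e T s, e T w} \<subseteq> {g \<in> uedges T. s \<in> uends T g}"
        using es ew w(3) by auto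
      moreover have "finite (uedges T)" using stD(1)[OF T] by (simp add: wf_ugraph_def)
      ultimately have "2 \<le> ug_degree T s"
        unfolding ug_degree_def using card_mono[of "{g \<in> uedges T. s \<in> uends T g}" "{e T s, e T w}"]
        by simp
      then show ?thesis using sT s by (auto simp: ug_int_def)
    qed (use s in auto)
  qed
  have arcs_disj: "arcs (A T) \<inter> arcs (A T') = {}" if "T \<in> \<T>" "T' \<in> \<T>" "T \<noteq> T'" for T T'
    using CIST_disjoint(1)[OF C that] parent(2)[OF that(1)] parent(2)[OF that(2)]
    by (fastforce simp: Asel arc_def)
  have arcs_ne: "arcs (A T) \<noteq> {}" for T
  proof -
    have "\<not> R \<subseteq> {\<rho> T}" using R2 card_mono[of "{\<rho> T}" R] by auto
    then show ?thesis by (auto simp: Asel)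
  qed
  \<comment> \<open>A nonempty arc set is not disjoint from itself, so distinct trees give distinct
    arborescences and their number is \<open>k\<close>.\<close>
  have injA: "inj_on A \<T>" using arcs_disj arcs_ne by (metis inf.idem inj_onI)
  have "CISA D k (A ` \<T>)"
    unfolding CISA_def
  proof (intro conjI ballI impI)
    show "finite (A ` \<T>)" "card (A ` \<T>) = k"
      using C injA by (auto simp: CIST_def card_image)
    fix B assume "B \<in> A ` \<T>"
    then obtain T where T: "T \<in> \<T>" "B = A T" by auto
    show "spanning B D" "arborescence B" using T span arb by auto
    fix B' assume "B' \<in> A ` \<T>" and ne: "B \<noteq> B'"
    then obtain T' where T': "T' \<in> \<T>" "B' = A T'" by auto
    have "T \<noteq> T'" using T T' ne by auto
    then show "arcs B \<inter> arcs B' = {}" using T T' arcs_disj by auto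
    have "V ` (ug_int T \<inter> R \<union> {\<rho> T}) \<inter> V ` (ug_int T' \<inter> R \<union> {\<rho> T'}) = {}"
      using disj[OF T(1) T'(1) \<open>T \<noteq> T'\<close>] \<rho>[OF T(1)] \<rho>[OF T'(1)]
      by (subst inj_on_image_Int[OF injV, symmetric]) auto
    then show "ug_int (underlying B) \<inter> ug_int (underlying B') = {}"
      using Int_mono[OF int[OF T(1)] int[OF T'(1)]] unfolding T(2) T'(2) by (metis subset_empty)
  qed
  then show ?thesis using mp by (auto simp: is_directed_minor_def D_def)
qed

section \<open>Choice of the roots in the two cases\<close>

theorem theorem3p26:
  fixes G :: "('v, 'e) ugraph" and R :: "'v set" and k :: nat
  assumes "wf_ugraph G" and "ug_connected G"
    and "R \<subseteq> uverts G" and "card R \<ge> 2"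
    and "k \<le> card R"
    and "(\<exists>\<T>. pendant_CIST G R k \<T>) \<or> (\<exists>\<T>. non_pendant_CIST G R k \<T>)"
  shows "\<exists>D. is_directed_minor G R D \<and> (\<exists>\<A>. CISA D k \<A>)"
  using assms(6)
proof
  assume "\<exists>\<T>. pendant_CIST G R k \<T>"
  then obtain \<T> where C: "CIST G R k \<T>" and pend: "\<And>T. T \<in> \<T> \<Longrightarrow> ug_leaves T = R"
    by (auto simp: pendant_CIST_def pendant_def)
  have "finite R" using assms(4) by (metis card.infinite not_numeral_le_zero)
  moreover have "finite \<T>" "card \<T> \<le> card R" using C assms(5) by (auto simp: CIST_def)
  \<comment> \<open>No terminal is inner in a pendant tree, so the sets to be made disjoint are the
    singletons of the roots, and any injection into \<open>R\<close> serves.\<close>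
  ultimately obtain \<rho> where "inj_on \<rho> \<T>" "\<rho> ` \<T> \<subseteq> R" using card_le_inj[of \<T> R] by blast
  moreover have "ug_int T \<inter> R = {}" if "T \<in> \<T>" for T
    using pend[OF that] by (auto simp: ug_leaves_def)
  ultimately show ?thesis
    by (intro CIST_imp_CISA[OF assms(1-4) C, of \<rho>]) (auto simp: inj_on_def)
next
  assume "\<exists>\<T>. non_pendant_CIST G R k \<T>"
  then obtain \<T> where C: "CIST G R k \<T>" and "\<And>T. T \<in> \<T> \<Longrightarrow> ug_int T \<inter> R \<noteq> {}"
    by (auto simp: non_pendant_CIST_def non_pendant_def)
  \<comment> \<open>With an inner terminal as root, the set of each tree lies in its
    \<open>ug_int\<close>, and these are disjoint by \<open>CIST_disjoint\<close>.\<close>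
  then obtain \<rho> where \<rho>: "\<And>T. T \<in> \<T> \<Longrightarrow> \<rho> T \<in> ug_int T \<inter> R"
    unfolding ex_in_conv[symmetric] by metis
  show ?thesis
  proof (rule CIST_imp_CISA[OF assms(1-4) C, of \<rho>])
    show "\<rho> T \<in> R" if "T \<in> \<T>" for T using \<rho>[OF that] by simp
    show "(ug_int T \<inter> R \<union> {\<rho> T}) \<inter> (ug_int T' \<inter> R \<union> {\<rho> T'}) = {}"
      if "T \<in> \<T>" "T' \<in> \<T>" "T \<noteq> T'" for T T'
      using CIST_disjoint(2)[OF C that] \<rho>[OF that(1)] \<rho>[OF that(2)] by auto
  qed
qed

end
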